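(* Assume linear recharge, i.e. $\varphi(\ell,\tau)=\max(0,\min(M,\ell+\alpha\tau))$ for some $\alpha>0$. Let $a=(u=s_0,s_1,\ldots,s_k,s_{k+1}=v)$, $k\ge1$, be a station sequence between $u$ and $v$, and set $$\ell_{\mathrm{av}}=\alpha\Big(t^{\mathrm b}_v-t^{\mathrm e}_u-\sum_{i=1}^{k+1}\delta_{s_{i-1},s_i}\Big),\qquad \Delta_{\mathrm{inc}}=\ell_{\mathrm{av}}-\sum_{i=1}^{k+1}e_{s_{i-1},s_i}-e_v .$$ Let $\Delta$ be defined as $\overrightarrow f_a\big(\overleftarrow f_a(0)\big)-\overleftarrow f_a(0)$. Then for all $x,y\in[0,M]$, $$\overrightarrow f_a(x)=\begin{cases}\min\big(\overrightarrow f_a(M),\,x+\Delta\big)&\text{if }x\ge\overleftarrow f_a(0),\\-\infty&\text{otherwise,}\end{cases}\qquad \overleftarrow f_a(y)=\begin{cases}\overleftarrow f_a(0)+\max\big(0,\,y-\Delta\big)&\text{if }y\le\overrightarrow f_a(M),\\+\infty&\text{otherwise,}\end{cases}$$ and the following closed formulas hold for $\overleftarrow f_a(0)$, $\overrightarrow f_a(M)$ and $\Delta$: $$\overleftarrow f_a(0)=\max\big(e_{u,s_1},-\Delta_{\mathrm{inc}}\big),$$ $$\overrightarrow f_a(M)=\min\Big(M,\;M+\ell_{\mathrm{av}}-\sum_{i=1}^{k}e_{s_{i-1},s_i}\Big)-e_{s_k,v}-e_v,$$ $$\Delta=\min\big(\Delta_{\mathrm{inc}},\;\overrightarrow f_a(M)-\overleftarrow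 f_a(0)\big).$$
   Context: $M>0$ is the battery capacity and $\varphi(\ell,\tau)$ is the level after charging for a duration $\tau\ge 0$ from level $\ell\in[0,M]$; $\varphi(-\infty,\tau)=-\infty$. Station sequences. There are sets $\mathcal T$ (services), $\mathcal D$ (depots), $\mathcal S$ (charging stations), and a horizon $[0,t_{\max}]$. Each service $w$ has a fixed begin time $t^{\mathrm b}_w$ and end time $t^{\mathrm e}_w$; for a depot $w$, $t^{\mathrm b}_w=t_{\max}$ and $t^{\mathrm e}_w=0$. $\delta_{w,w'}\ge 0$ and $e_{w,w'}\ge0$ are the travel time and energy needed to go from $w$ to $w'$; $e_w\ge0$ is the energy consumed by service $w$, with $e_w=0$ for depots and stations. For $u,v\in\mathcal D\cup\mathcal T$, a station sequence between $u$ and $v$ is a sequence $u=s_0,s_1,\ldots,s_k,s_{k+1}=v$ with $s_1,\ldots,s_k\in\mathcal S$ such that $t^{\mathrm e}_u+\sum_{i=1}^{k+1}\delta_{s_{i-1},s_i}\le t^{\mathrm b}_v$, $e_u+e_{u,s_1}\le M$, $e_{s_{i-1},s_i}\le M$ for $1\le i\le k$, and $e_{s_k,v}+e_v\le M$. Schedules and levels. A schedule is a vector $\mathbf t=(t^{\mathrm b}_1,t^{\mathrm e}_1,\ldots,t^{\mathrm b}_k,t^{\mathrm e}_k)$ of arrival and departure times at $s_1,\ldots,s_k$. With $t^{\mathrm e}_0=t^{\mathrm e}_u$ and $t^{\mathrm b}_{k+1}=t^{\mathrm b}_v$, it is feasible if $t^{\mathrm b}_i=t^{\mathrm e}_{i-1}+\delta_{s_{i-1},s_i}$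 for $1\le i\le k+1$ and $t^{\mathrm b}_i\le t^{\mathrm e}_i$ for $1\le i\le k$. Let $\mathrm{pos}(z)=z$ if $z\ge0$ and $-\infty$ otherwise. For an initial level $x\in[0,M]\cup\{-\infty\}$ at the end of $u$: $\ell^{\mathrm e}_0(x,\mathbf t)=x$; $\ell^{\mathrm b}_i(x,\mathbf t)=\mathrm{pos}(\ell^{\mathrm e}_{i-1}(x,\mathbf t)-e_{s_{i-1},s_i})$ for $1\le i\le k+1$; for $1\le i\le k$, $\ell^{\mathrm e}_i(x,\mathbf t)=\varphi(\ell^{\mathrm b}_i(x,\mathbf t),t^{\mathrm e}_i-t^{\mathrm b}_i)$ if $t^{\mathrm e}_i\ge t^{\mathrm b}_i$ and $-\infty$ otherwise; $\ell^{\mathrm e}_{k+1}(x,\mathbf t)=\mathrm{pos}(\ell^{\mathrm b}_{k+1}(x,\mathbf t)-e_v)$. Define $\overrightarrow f_a(x)=\max\{\ell^{\mathrm e}_{k+1}(x,\mathbf t):\mathbf t\text{ feasible}\}$ (maximum final level given initial level $x$), and for $y\in[0,M]$, $\overleftarrow f_a(y)=\min\{x:\overrightarrow f_a(x)\ge y\}$, with $\min\emptyset=+\infty$.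
   Formalization: The formula for ←f_a(y) is corrected to ←f_a(0)+max(0, y−(←f_a(0)+Δ)), the printed one being false when ←f_a(0)≠0; the three closed formulas are stated only when ←f_a(0)≠+∞, as otherwise Δ is undefined and the closed formula for ←f_a(0) fails. *)

theory Defs
  imports Complex_Main "HOL-Library.Extended_Real"
begin

text \<open>
  Locations are services, depots and charging stations. The charging function \<open>charge N l \<tau>\<close> is the
  level reached from a level \<open>l\<close> in \<open>[0, capacity N]\<close> after charging for \<open>\<tau> \<ge> 0\<close>.
\<close>

record 'w network =
  services :: "'w set"
  depots :: "'w set"
  stations :: "'w set"
  horizon :: real
  capacity :: real
  t_begin :: "'w \<Rightarrow> real"
  t_end :: "'w \<Rightarrow> real"
  travel :: "'w \<Rightarrow> 'w \<Rightarrow> real"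
  leg_energy :: "'w \<Rightarrow> 'w \<Rightarrow> real"
  energy :: "'w \<Rightarrow> real"
  charge :: "real \<Rightarrow> real \<Rightarrow> real"

definition network :: "'w network \<Rightarrow> bool" where
  "network N \<longleftrightarrow>
     capacity N > 0 \<and> horizon N \<ge> 0 \<and>
     (\<forall>w\<in>depots N. t_begin N w = horizon N \<and> t_end N w = 0) \<and>
     (\<forall>w w'. travel N w w' \<ge> 0 \<and> leg_energy N w w' \<ge> 0) \<and>
     (\<forall>w. energy N w \<ge> 0) \<and>
     (\<forall>w\<in>depots N \<union> stations N. energy N w = 0)"

text \<open>
  A sequence \<open>s\<^sub>0, s\<^sub>1, \<dots>, s\<^sub>k, s\<^sub>k\<^sub>+\<^sub>1\<close> is the list \<open>a\<close> of length \<open>k + 2\<close> with \<open>s\<^sub>i = a ! i\<close>.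
\<close>

definition num_stations :: "'w list \<Rightarrow> nat" where
  "num_stations a = length a - 2"

definition station_sequence :: "'w network \<Rightarrow> 'w \<Rightarrow> 'w \<Rightarrow> 'w list \<Rightarrow> bool" where
  "station_sequence N u v a \<longleftrightarrow>
     (let k = num_stations a in
      length a = k + 2 \<and> a ! 0 = u \<and> a ! (k + 1) = v \<and>
      u \<in> depots N \<union> services N \<and> v \<in> depots N \<union> services N \<and>
      (\<forall>i\<in>{1..k}. a ! i \<in> stations N) \<and>
      t_end N u + (\<Sum>i=1..k+1. travel N (a ! (i - 1)) (a ! i)) \<le> t_begin N v \<and>
      energy N u + leg_energy N u (a ! 1) \<le> capacity N \<and>
      (\<forall>i\<in>{1..k}. leg_energy N (a ! (i - 1)) (a ! i) \<le> capacity N) \<and>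
      leg_energy N (a ! k) v + energy N v \<le> capacity N)"

text \<open>
  A schedule is the list of its \<open>k\<close> pairs (arrival, departure); pair number \<open>i\<close> is \<open>t ! (i - 1)\<close>.
  Arrivals are meant for \<open>1 \<le> i \<le> k + 1\<close> and departures for \<open>0 \<le> i \<le> k\<close>.
\<close>

type_synonym schedule = "(real \<times> real) list"

definition arrival :: "'w network \<Rightarrow> 'w list \<Rightarrow> schedule \<Rightarrow> nat \<Rightarrow> real" where
  "arrival N a t i =
     (if i = num_stations a + 1 then t_begin N (a ! i) else fst (t ! (i - 1)))"

definition departure :: "'w network \<Rightarrow> 'w list \<Rightarrow> schedule \<Rightarrow> nat \<Rightarrow> real" where
  "departure N a t i = (if i = 0 then t_end N (a ! 0) else snd (t ! (i - 1)))"

definition feasible :: "'w network \<Rightarrow> 'w list \<Rightarrow> schedule \<Rightarrow> bool" where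
  "feasible N a t \<longleftrightarrow>
     length t = num_stations a \<and>
     (\<forall>i\<in>{1..num_stations a + 1}.
        arrival N a t i = departure N a t (i - 1) + travel N (a ! (i - 1)) (a ! i)) \<and>
     (\<forall>i\<in>{1..num_stations a}. arrival N a t i \<le> departure N a t i)"

definition pos :: "ereal \<Rightarrow> ereal" where
  "pos z = (if z \<ge> 0 then z else -\<infinity>)"

text \<open>Levels are the reals in \<open>[0, capacity N]\<close> together with \<open>-\<infinity>\<close>.\<close>

definition levels :: "'w network \<Rightarrow> ereal set" where
  "levels N = {0..ereal (capacity N)} \<union> {-\<infinity>}"

definition charge_level :: "'w network \<Rightarrow> ereal \<Rightarrow> real \<Rightarrow> ereal" where
  "charge_level N l \<tau> = (if l = -\<infinity> then -\<infinity> else ereal (charge N (real_of_ereal l) \<tau>))"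

definition leg_arrival :: "'w network \<Rightarrow> 'w list \<Rightarrow> nat \<Rightarrow> ereal \<Rightarrow> ereal" where
  "leg_arrival N a i l = pos (l - ereal (leg_energy N (a ! (i - 1)) (a ! i)))"

text \<open>
  \<open>level_end N a x t i\<close> is \<open>\<ell>\<^sup>e\<^sub>i(x, t)\<close> for \<open>0 \<le> i \<le> k + 1\<close>; in its recursion,
  \<open>leg_arrival N a (Suc i) (level_end N a x t i)\<close> is \<open>\<ell>\<^sup>b\<^sub>i\<^sub>+\<^sub>1(x, t)\<close>.
\<close>

primrec level_end :: "'w network \<Rightarrow> 'w list \<Rightarrow> ereal \<Rightarrow> schedule \<Rightarrow> nat \<Rightarrow> ereal" where
  "level_end N a x t 0 = x"
| "level_end N a x t (Suc i) =
     (let b = leg_arrival N a (Suc i) (level_end N a x t i) in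
      if Suc i = num_stations a + 1 then pos (b - ereal (energy N (a ! Suc i)))
      else if departure N a t (Suc i) \<ge> arrival N a t (Suc i)
      then charge_level N b (departure N a t (Suc i) - arrival N a t (Suc i))
      else -\<infinity>)"

text \<open>
  The maximum and the minimum are \<open>Greatest\<close> and \<open>Least\<close>, not \<open>Sup\<close> and \<open>Inf\<close>: their values are
  specified only if they are attained. \<open>forward N a x\<close> is meant for \<open>x\<close> in \<open>levels N\<close> only.
\<close>

definition forward :: "'w network \<Rightarrow> 'w list \<Rightarrow> ereal \<Rightarrow> ereal" where
  "forward N a x =
     (GREATEST l. \<exists>t. feasible N a t \<and> l = level_end N a x t (num_stations a + 1))"

definition backward :: "'w network \<Rightarrow> 'w list \<Rightarrow> real \<Rightarrow> ereal" where
  "backward N a y =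
     (if \<exists>x\<in>levels N. forward N a x \<ge> ereal y
      then LEAST x. x \<in> levels N \<and> forward N a x \<ge> ereal y
      else \<infinity>)"

definition linear_recharge :: "'w network \<Rightarrow> real \<Rightarrow> bool" where
  "linear_recharge N \<alpha> \<longleftrightarrow>
     (\<forall>l\<in>{0..capacity N}. \<forall>\<tau>\<ge>0. charge N l \<tau> = max 0 (min (capacity N) (l + \<alpha> * \<tau>)))"

end

theory Submission
  imports Defs
begin

text \<open>
  A schedule only decides how the total charge \<open>l_av\<close> is split among the stations. However it is
  split, the level on leaving \<open>s\<^sub>i\<close> is at most \<open>M\<close> and at most the initial level plus the charge offered
  so far minus the energy spent so far. Charging as early as possible attains the smaller bound at \<open>s\<^sub>k\<close>, and
  it never runs out of energy unless the initial level is below \<open>e\<^bsub>u,s\<^sub>1\<^esub>\<close> or the final level would be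
  negative. Hence the maximal final level is an explicit truncated translation of the initial level.
\<close>

text \<open>Meant for evaluating \<open>backward\<close>: the levels satisfying \<open>P\<close>
  form exactly the interval \<open>{ereal b..ereal M}\<close>, whose left end is the minimum
  whenever the interval is nonempty.\<close>

lemma Least_threshold_ereal:
  assumes "\<And>x. x \<in> {0..M} \<Longrightarrow> P (ereal x) \<longleftrightarrow> b \<le> x" and "\<not> P (-\<infinity>)" and "0 \<le> b"
  shows "(if \<exists>x\<in>{0..ereal M} \<union> {-\<infinity>}. P x
          then LEAST x. x \<in> {0..ereal M} \<union> {-\<infinity>} \<and> P x else \<infinity>)
         = (if b \<le> M then ereal b else \<infinity>)"
proof -
  have char: "x \<in> {0..ereal M} \<union> {-\<infinity>} \<and> P x \<longleftrightarrow> x \<in> {ereal b..ereal M}" for x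
    using assms by (cases x) auto
  have "(LEAST x. x \<in> {ereal b..ereal M}) = ereal b" if "b \<le> M"
    using that by (intro Least_equality) auto
  moreover have "(\<exists>x. x \<in> {ereal b..ereal M}) \<longleftrightarrow> b \<le> M"
    by (metis atLeastAtMost_iff ereal_less_eq(3) order_refl order_trans)
  ultimately show ?thesis
    unfolding Bex_def char by auto
qed

section \<open>Sequence data and cumulative charge\<close>

locale linear_station_sequence =
  fixes N :: "'w network" and u v :: 'w and a :: "'w list" and \<alpha> :: real
  assumes network: "network N"
    and rate_pos: "\<alpha> > 0" and linear: "linear_recharge N \<alpha>"
    and sequence: "station_sequence N u v a" and stations_pos: "num_stations a \<ge> 1"
begin

abbreviation "k \<equiv> num_stations a"
abbreviation "M \<equiv> capacity N"
abbreviation "leg i \<equiv> leg_energy N (a ! (i - 1)) (a ! i)"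
abbreviation "spent i \<equiv> \<Sum>j=1..i. leg j"
abbreviation "travelled i \<equiv> \<Sum>j=1..i. travel N (a ! (j - 1)) (a ! j)"

definition available :: real where
  "available = \<alpha> * (t_begin N v - t_end N u - travelled (k + 1))"

definition increment :: real where
  "increment = available - spent (k + 1) - energy N v"

text \<open>In a feasible schedule all time not spent travelling is spent charging, so this is the
  charge offered up to the departure from station \<open>i\<close>, before capping at the capacity.
  It serves as the coordinate of a schedule: it starts at 0, never decreases and ends at
  \<open>available\<close>.\<close>

definition offered :: "schedule \<Rightarrow> nat \<Rightarrow> real" where
  "offered t i = \<alpha> * (departure N a t i - t_end N u - travelled i)"

lemma endpoints: "a ! 0 = u" "a ! Suc k = v"
  using sequence by (auto simp: station_sequence_def Let_def)

lemma leg_nonneg: "0 \<le> leg i"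
  using network by (simp add: network_def)

lemma energy_nonneg: "0 \<le> energy N w"
  using network by (simp add: network_def)

lemma leg_le_capacity: "i \<in> {1..k} \<Longrightarrow> leg i \<le> M"
  using sequence unfolding station_sequence_def Let_def by blast

lemma last_leg_le_capacity: "leg (Suc k) + energy N v \<le> M"
  using sequence by (simp add: station_sequence_def Let_def)

lemma available_nonneg: "0 \<le> available"
  using sequence rate_pos by (simp add: available_def station_sequence_def Let_def del: sum.cl_ivl_Suc)

lemma spent_mono: "i \<le> j \<Longrightarrow> spent i \<le> spent j"
  using leg_nonneg by (intro sum_mono2) auto

section \<open>The level recursion in terms of cumulative charge\<close>

lemma charge_linear:
  assumes "l \<in> {0..M}" and "0 \<le> \<tau>"
  shows "charge_level N (ereal l) \<tau> = ereal (min M (l + \<alpha> * \<tau>))"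
proof -
  have "0 \<le> min M (l + \<alpha> * \<tau>)"
    using assms rate_pos by simp
  then show ?thesis
    using linear assms by (simp add: charge_level_def linear_recharge_def)
qed

text \<open>The travel time in the arrival equation cancels against the one in
  \<open>offered\<close>, so the charging time is an increment of \<open>offered\<close> divided by
  the rate. With \<open>level_end_final\<close>, this replaces all later unfolding of the
  recursion.\<close>

lemma level_end_station:
  assumes t: "feasible N a t" and "i < k"
  shows "level_end N a x t (Suc i) =
    charge_level N (leg_arrival N a (Suc i) (level_end N a x t i))
      ((offered t (Suc i) - offered t i) / \<alpha>)"
    and "offered t i \<le> offered t (Suc i)"
proof -
  have arr: "arrival N a t (Suc i) = departure N a t i + travel N (a ! i) (a ! Suc i)"
    and le: "arrival N a t (Suc i) \<le> departure N a t (Suc i)"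
    using t \<open>i < k\<close> unfolding feasible_def by force+
  have dur: "(offered t (Suc i) - offered t i) / \<alpha> = departure N a t (Suc i) - arrival N a t (Suc i)"
    using rate_pos arr by (simp add: offered_def field_simps)
  show "level_end N a x t (Suc i) =
    charge_level N (leg_arrival N a (Suc i) (level_end N a x t i))
      ((offered t (Suc i) - offered t i) / \<alpha>)"
    using \<open>i < k\<close> le unfolding dur by (simp add: Let_def)
  have "0 \<le> (offered t (Suc i) - offered t i) / \<alpha>"
    unfolding dur using le by simp
  then show "offered t i \<le> offered t (Suc i)"
    using rate_pos by (simp add: zero_le_divide_iff)
qed

lemma level_end_final:
  "level_end N a x t (Suc k) =
     pos (leg_arrival N a (Suc k) (level_end N a x t k) - ereal (energy N v))"
  by (simp add: Let_def endpoints)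

declare level_end.simps(2) [simp del]

lemma offered_0: "offered t 0 = 0"
  by (simp add: offered_def departure_def endpoints)

lemma offered_last:
  assumes "feasible N a t"
  shows "offered t k = available"
proof -
  have "arrival N a t (Suc k) = departure N a t k + travel N (a ! k) (a ! Suc k)"
    using assms unfolding feasible_def by force
  then show ?thesis
    by (simp add: offered_def available_def arrival_def endpoints)
qed

lemma pos_ereal: "pos (ereal r) = (if 0 \<le> r then ereal r else -\<infinity>)"
  by (simp add: pos_def)

lemma pos_MInf: "pos (-\<infinity>) = -\<infinity>"
  by (simp add: pos_def)

lemma charge_MInf: "charge_level N (-\<infinity>) \<tau> = -\<infinity>"
  by (simp add: charge_level_def)

text \<open>The two truncations merge into one test: since the energy of \<open>v\<close> is
  nonnegative, a battery that fails on the last leg also fails the combined test.\<close>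

lemma final_level_ereal:
  "level_end N a x t k = ereal r \<Longrightarrow>
   level_end N a x t (Suc k) =
     (if leg (Suc k) + energy N v \<le> r then ereal (r - leg (Suc k) - energy N v) else -\<infinity>)"
  using energy_nonneg[of v] by (simp add: level_end_final leg_arrival_def pos_ereal pos_MInf)

lemma final_level_MInf: "level_end N a x t k = -\<infinity> \<Longrightarrow> level_end N a x t (Suc k) = -\<infinity>"
  by (simp add: level_end_final leg_arrival_def pos_MInf)

section \<open>Bounds for an arbitrary feasible schedule\<close>

lemma level_end_MInf:
  assumes "feasible N a t" and "i \<le> k"
  shows "level_end N a (-\<infinity>) t i = -\<infinity>"
  using \<open>i \<le> k\<close>
proof (induction i)
  case (Suc i)
  then show ?case
    by (simp add: level_end_station(1)[OF assms(1)] leg_arrival_def pos_MInf charge_MInf)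
qed simp

text \<open>Legs subtract exactly and charging adds at most what is offered, so the bound
  telescopes. The last clause records that the first leg precedes any charging; it supplies one half
  of the threshold on \<open>x\<close>.\<close>

lemma level_end_bound:
  assumes t: "feasible N a t" and x: "x \<in> {0..M}" and "i \<le> k"
  obtains "level_end N a (ereal x) t i = -\<infinity>"
  | r where "level_end N a (ereal x) t i = ereal r" "0 \<le> r" "r \<le> M"
      "r \<le> x + offered t i - spent i" "0 < i \<Longrightarrow> leg 1 \<le> x"
  using \<open>i \<le> k\<close>
proof (induction i arbitrary: thesis)
  case 0
  show ?case using 0(2)[of x] x by (simp add: offered_0)
next
  case (Suc i)
  note step = level_end_station(1)[OF t, of i "ereal x"] level_end_station(2)[OF t, of i]
  have "i < k" using Suc.prems by simp
  show ?case
  proof (rule Suc.IH)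
    show "i \<le> k" using \<open>i < k\<close> by simp
  next
    assume "level_end N a (ereal x) t i = -\<infinity>"
    then show thesis
      using Suc.prems(1) \<open>i < k\<close>
      by (simp add: step leg_arrival_def pos_MInf charge_MInf)
  next
    fix r assume r: "level_end N a (ereal x) t i = ereal r" "0 \<le> r" "r \<le> M"
      "r \<le> x + offered t i - spent i" "0 < i \<Longrightarrow> leg 1 \<le> x"
    let ?\<tau> = "(offered t (Suc i) - offered t i) / \<alpha>"
    show thesis
    proof (cases "leg (Suc i) \<le> r")
      case False
      then show thesis
        using Suc.prems(1) \<open>i < k\<close> r
        by (simp add: step leg_arrival_def pos_ereal charge_MInf)
    next
      case True
      have \<tau>: "0 \<le> ?\<tau>" "\<alpha> * ?\<tau> = offered t (Suc i) - offered t i"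
        using step(2)[OF \<open>i < k\<close>] rate_pos by simp_all
      have lev: "level_end N a (ereal x) t (Suc i) =
          ereal (min M (r - leg (Suc i) + (offered t (Suc i) - offered t i)))"
      proof -
        have "leg_arrival N a (Suc i) (level_end N a (ereal x) t i) = ereal (r - leg (Suc i))"
          using True r by (simp add: leg_arrival_def pos_ereal)
        moreover have "r - leg (Suc i) \<in> {0..M}"
          using True r leg_nonneg[of "Suc i"] by auto
        ultimately show ?thesis
          using charge_linear[OF _ \<tau>(1)] \<tau>(2) step(1)[OF \<open>i < k\<close>] by metis
      qed
      show thesis
      proof (rule Suc.prems(2)[OF lev])
        show "0 \<le> min M (r - leg (Suc i) + (offered t (Suc i) - offered t i))"
          using True r step(2)[OF \<open>i < k\<close>] by simp
        show "min M (r - leg (Suc i) + (offered t (Suc i) - offered t i))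
            \<le> x + offered t (Suc i) - spent (Suc i)"
          using r by simp
        show "leg 1 \<le> x"
        \<comment> \<open>At \<open>i = 0\<close> the level \<open>r\<close> is \<open>x\<close>
          itself, so the test for the first leg is the claim; later it is inherited.\<close>
        proof (cases "i = 0")
          case True
          then show ?thesis using \<open>leg (Suc i) \<le> r\<close> r(1) by simp
        qed (use r(5) in simp)
      qed simp
    qed
  qed
qed

section \<open>A schedule attaining the bound\<close>

text \<open>
  The greedy schedule: before the last station, the charge offered so far is just enough to leave
  with a full battery, as long as the total allows; the last station gets all the rest.
\<close>

definition greedy_offer :: "real \<Rightarrow> nat \<Rightarrow> real" where
  "greedy_offer x i =
     (if i = 0 then 0 else if i < k then min available (M - x + spent i) else available)"

text \<open>Obtained by solving the equation of \<open>offered\<close> for the departure time, given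
  the prescribed cumulative charge.\<close>

definition greedy_departure :: "real \<Rightarrow> nat \<Rightarrow> real" where
  "greedy_departure x i = t_end N u + travelled i + greedy_offer x i / \<alpha>"

definition greedy :: "real \<Rightarrow> schedule" where
  "greedy x = map (\<lambda>i. (greedy_departure x i + travel N (a ! i) (a ! Suc i),
                        greedy_departure x (Suc i))) [0..<k]"

text \<open>Makes the charging times nonnegative. The start uses \<open>x \<le> M\<close>, the
  middle the growth of \<open>spent\<close>, and the last station can only raise the value to
  \<open>available\<close>.\<close>

lemma greedy_offer_mono:
  assumes "x \<in> {0..M}"
  shows "greedy_offer x i \<le> greedy_offer x (Suc i)"
proof -
  have "0 \<le> spent (Suc i)" by (intro sum_nonneg leg_nonneg)
  moreover have "spent i \<le> spent (Suc i)" by (rule spent_mono) simp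
  ultimately show ?thesis
    using assms available_nonneg unfolding greedy_offer_def by auto
qed

lemma departure_greedy: "i \<le> k \<Longrightarrow> departure N a (greedy x) i = greedy_departure x i"
  by (cases i) (auto simp: departure_def greedy_def greedy_departure_def greedy_offer_def endpoints)

lemma offered_greedy: "i \<le> k \<Longrightarrow> offered (greedy x) i = greedy_offer x i"
  using rate_pos by (simp add: offered_def departure_greedy greedy_departure_def)

lemma feasible_greedy:
  assumes "x \<in> {0..M}"
  shows "feasible N a (greedy x)"
  unfolding feasible_def
proof (intro conjI ballI)
  show "length (greedy x) = k" by (simp add: greedy_def)
next
  fix i assume i: "i \<in> {1..k + 1}"
  then obtain j where j: "i = Suc j" "j \<le> k" by (cases i) auto
  \<comment> \<open>Since \<open>k \<ge> 1\<close>, index \<open>k\<close> gets the offer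
    \<open>available\<close>, which makes the arrival at \<open>v\<close> exactly punctual, as
    feasibility demands.\<close>
  have "greedy_departure x k = t_begin N v - travel N (a ! k) (a ! Suc k)"
    using rate_pos stations_pos
    by (simp add: greedy_departure_def greedy_offer_def available_def)
  then have "arrival N a (greedy x) i = greedy_departure x j + travel N (a ! j) (a ! Suc j)"
    using j by (auto simp: arrival_def endpoints greedy_def)
  then show "arrival N a (greedy x) i
      = departure N a (greedy x) (i - 1) + travel N (a ! (i - 1)) (a ! i)"
    using j by (simp add: departure_greedy)
next
  fix i assume i: "i \<in> {1..k}"
  then obtain j where j: "i = Suc j" "j < k" by (cases i) auto
  have "greedy_offer x j / \<alpha> \<le> greedy_offer x (Suc j) / \<alpha>"
    using greedy_offer_mono[OF assms] rate_pos by (simp add: divide_right_mono)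
  moreover have "arrival N a (greedy x) i = greedy_departure x j + travel N (a ! j) (a ! Suc j)"
    using j by (simp add: arrival_def greedy_def)
  ultimately show "arrival N a (greedy x) i \<le> departure N a (greedy x) i"
    using j by (simp add: departure_greedy greedy_departure_def)
qed

lemma level_end_greedy:
  assumes x: "x \<in> {0..M}" "leg 1 \<le> x" "0 \<le> x + increment" and "i \<le> k"
  shows "level_end N a (ereal x) (greedy x) i = ereal (min M (x + greedy_offer x i - spent i))"
  using \<open>i \<le> k\<close>
proof (induction i)
  case 0
  then show ?case using x by (simp add: greedy_offer_def)
next
  case (Suc i)
  then have "i < k" by simp
  define l where "l = x + greedy_offer x i - spent i - leg (Suc i)"
  let ?d = "greedy_offer x (Suc i) - greedy_offer x i"
  \<comment> \<open>Before the last station the offer never exceeds what fills the battery, so the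
    cap at \<open>M\<close> loses nothing.\<close>
  have le_M: "x + greedy_offer x i - spent i \<le> M"
    using \<open>i < k\<close> x by (auto simp: greedy_offer_def min_def)
  have "0 \<le> x + available - spent (Suc i)"
    using x(3) energy_nonneg[of v] spent_mono[of "Suc i" "k + 1"] \<open>i < k\<close>
    unfolding increment_def by linarith
  \<comment> \<open>Three cases: the first leg is covered by \<open>x\<close>; after a full charge
    the leg costs at most \<open>M\<close>; and once all of \<open>available\<close> is used, the
    nonnegative final balance covers every remaining leg.\<close>
  then have "0 \<le> l"
    using x leg_le_capacity[of "Suc i"] \<open>i < k\<close> by (auto simp: l_def greedy_offer_def)
  then have "leg_arrival N a (Suc i) (level_end N a (ereal x) (greedy x) i) = ereal l"
    using Suc le_M by (simp add: leg_arrival_def pos_ereal l_def)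
  moreover have "l \<in> {0..M}"
    using \<open>0 \<le> l\<close> le_M leg_nonneg[of "Suc i"] by (simp add: l_def)
  moreover have "0 \<le> ?d / \<alpha>" "\<alpha> * (?d / \<alpha>) = ?d"
    using greedy_offer_mono[OF x(1)] rate_pos by simp_all
  ultimately have "level_end N a (ereal x) (greedy x) (Suc i) = ereal (min M (l + ?d))"
    using level_end_station(1)[OF feasible_greedy[OF x(1)] \<open>i < k\<close>] \<open>i < k\<close> charge_linear
    by (simp add: offered_greedy)
  moreover have "l + ?d = x + greedy_offer x (Suc i) - spent (Suc i)"
    by (simp add: l_def)
  ultimately show ?case by (simp only:)
qed

section \<open>Closed forms of the forward and backward functions\<close>

lemma forward_eqI:
  assumes "feasible N a t" and "level_end N a x t (Suc k) = l"
    and "\<And>s. feasible N a s \<Longrightarrow> level_end N a x s (Suc k) \<le> l"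
  shows "forward N a x = l"
  unfolding forward_def using assms by (intro Greatest_equality) auto

lemma forward_MInf: "forward N a (-\<infinity>) = -\<infinity>"
proof -
  \<comment> \<open>The greedy schedule from level 0 serves here only as a witness that some
    schedule is feasible.\<close>
  have "0 \<in> {0..M}" using network by (simp add: network_def)
  note f = feasible_greedy[OF this]
  have "level_end N a (-\<infinity>) s (Suc k) = -\<infinity>" if "feasible N a s" for s
    using final_level_MInf level_end_MInf[OF that] by blast
  then show ?thesis using forward_eqI f by (metis order_refl)
qed

text \<open>Surviving to the end forces both halves of the threshold: the first leg gives
  \<open>leg 1 \<le> x\<close>, and the telescoped bound at \<open>k\<close> gives
  \<open>0 \<le> x + increment\<close>. Above the threshold the greedy schedule attains the
  bound.\<close>

lemma forward_closed:
  assumes x: "x \<in> {0..M}"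
  shows "forward N a (ereal x) =
    (if max (leg 1) (- increment) \<le> x
     then ereal (min M (x + available - spent k) - leg (Suc k) - energy N v) else -\<infinity>)"
    (is "_ = ?F")
proof -
  have total: "increment = available - spent k - leg (Suc k) - energy N v"
    by (simp add: increment_def)
  have upper: "level_end N a (ereal x) s (Suc k) \<le> ?F" if s: "feasible N a s" for s
  proof (rule level_end_bound[OF s x order_refl])
    assume "level_end N a (ereal x) s k = -\<infinity>"
    then show ?thesis by (simp add: final_level_MInf)
  next
    fix r assume r: "level_end N a (ereal x) s k = ereal r" "0 \<le> r" "r \<le> M"
      "r \<le> x + offered s k - spent k" "0 < k \<Longrightarrow> leg 1 \<le> x"
    then show ?thesis
      using stations_pos
      by (auto simp: final_level_ereal[OF r(1)] offered_last[OF s] total)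
  qed
  have "level_end N a (ereal x) (greedy x) (Suc k) = ?F"
  proof (cases "max (leg 1) (- increment) \<le> x")
    case True
    then have lev: "level_end N a (ereal x) (greedy x) k = ereal (min M (x + available - spent k))"
      using level_end_greedy[OF x _ _ order_refl] stations_pos by (simp add: greedy_offer_def)
    moreover have "leg (Suc k) + energy N v \<le> min M (x + available - spent k)"
      using True last_leg_le_capacity by (simp add: total)
    ultimately show ?thesis
      using True final_level_ereal[OF lev] by (simp del: ereal_min)
  next
    case False
    \<comment> \<open>Below the threshold the upper bound is already minus infinity, so any feasible
      schedule attains it.\<close>
    show ?thesis
      using upper[OF feasible_greedy[OF x]] unfolding if_not_P[OF False]
      by simp
  qed
  then show ?thesis by (rule forward_eqI[OF feasible_greedy[OF x] _ upper])
qed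

text \<open>Solve \<open>forward N a (ereal x) \<ge> ereal y\<close> for \<open>x\<close>. One
  argument of the minimum constrains \<open>y\<close> alone, the other gives
  \<open>y - increment \<le> x\<close>, which absorbs \<open>- increment \<le> x\<close> because
  \<open>0 \<le> y\<close>.\<close>

lemma backward_closed:
  assumes y: "0 \<le> y"
  shows "backward N a y =
    (if y \<le> M - leg (Suc k) - energy N v \<and> y - increment \<le> M
     then ereal (max (leg 1) (y - increment)) else \<infinity>)"
proof (cases "y \<le> M - leg (Suc k) - energy N v")
  case True
  have "forward N a (ereal x) \<ge> ereal y \<longleftrightarrow> max (leg 1) (y - increment) \<le> x" if "x \<in> {0..M}" for x
    using True y by (auto simp: forward_closed[OF that] increment_def)
  moreover have "\<not> forward N a (-\<infinity>) \<ge> ereal y"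
    by (simp add: forward_MInf)
  moreover have "0 \<le> max (leg 1) (y - increment)"
    using leg_nonneg[of 1] by simp
  moreover have "leg 1 \<le> M"
    using leg_le_capacity[of 1] stations_pos by simp
  ultimately show ?thesis
    using True unfolding backward_def levels_def
    by (subst Least_threshold_ereal[where b = "max (leg 1) (y - increment)"]) auto
next
  case False
  have "\<not> forward N a x \<ge> ereal y" if "x \<in> levels N" for x
    using that False forward_MInf
    by (cases x) (auto simp: levels_def forward_closed)
  then show ?thesis using False by (auto simp: backward_def)
qed

end

text \<open>Reaching \<open>y\<close> requires \<open>x + \<Delta> \<ge> y\<close>, so the excess
  over \<open>backward N a 0\<close> is \<open>y - (backward N a 0 + \<Delta>)\<close>; the start
  value has to be subtracted too. The closed formulas are guarded because their values are finite,
  whereas \<open>backward N a 0\<close> is infinite when no initial level suffices.\<close>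

theorem theorem3:
  fixes N :: "'w network" and u v :: 'w and a :: "'w list" and k :: nat
    and M \<alpha> l_av \<Delta>_inc :: real and \<Delta> :: ereal
  assumes "network N" and "M = capacity N"
    and "\<alpha> > 0" and "linear_recharge N \<alpha>"
    and "station_sequence N u v a" and "k = num_stations a" and "k \<ge> 1"
    and "l_av = \<alpha> * (t_begin N v - t_end N u - (\<Sum>i=1..k+1. travel N (a ! (i - 1)) (a ! i)))"
    and "\<Delta>_inc = l_av - (\<Sum>i=1..k+1. leg_energy N (a ! (i - 1)) (a ! i)) - energy N v"
    and "\<Delta> = forward N a (backward N a 0) - backward N a 0"
  shows
    "(\<forall>x\<in>{0..M}. forward N a (ereal x) =
        (if ereal x \<ge> backward N a 0 then min (forward N a (ereal M)) (ereal x + \<Delta>) else -\<infinity>)) \<and>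
     (\<forall>y\<in>{0..M}. backward N a y =
        (if ereal y \<le> forward N a (ereal M)
         then backward N a 0 + max 0 (ereal y - (backward N a 0 + \<Delta>)) else \<infinity>)) \<and>
     (backward N a 0 \<noteq> \<infinity> \<longrightarrow>
        backward N a 0 = ereal (max (leg_energy N u (a ! 1)) (- \<Delta>_inc)) \<and>
        forward N a (ereal M) =
          ereal (min M (M + l_av - (\<Sum>i=1..k. leg_energy N (a ! (i - 1)) (a ! i)))
                 - leg_energy N (a ! k) v - energy N v) \<and>
        \<Delta> = min (ereal \<Delta>_inc) (forward N a (ereal M) - backward N a 0))"
proof -
  interpret linear_station_sequence N u v a \<alpha>
    using assms by unfold_locales simp_all
  define b where "b = max (leg 1) (- increment)"
  define c where "c = M - leg (Suc k) - energy N v"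
  have l_av: "l_av = available" and inc: "\<Delta>_inc = increment"
    using assms by (simp_all add: available_def increment_def)
  have total: "increment = available - spent k - leg (Suc k) - energy N v"
    by (simp add: increment_def assms(6))
  have M: "0 < M" "0 \<le> c" "leg 1 \<le> M"
    using assms network last_leg_le_capacity leg_le_capacity[of 1]
    by (auto simp: c_def network_def)
  have "0 \<le> b"
    unfolding b_def by (intro max.coboundedI1 leg_nonneg)
  have fwd: "forward N a (ereal x) = (if b \<le> x then ereal (min c (x + increment)) else -\<infinity>)"
    if "x \<in> {0..M}" for x
    using forward_closed[of x] that assms(2,6) unfolding b_def c_def total by (auto simp: min_def)
  have bwd: "backward N a y = (if y \<le> c \<and> y - increment \<le> M then ereal (max b (y - increment)) else \<infinity>)"
    if "y \<in> {0..M}" for y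
  proof -
    have "max (leg 1) (y - increment) = max b (y - increment)"
      using that unfolding b_def by (auto simp: max_def)
    then show ?thesis
      using backward_closed[of y] that assms(2,6) unfolding c_def by (simp only: atLeastAtMost_iff)
  qed
  show ?thesis
  proof (cases "b \<le> M")
    \<comment> \<open>No initial level suffices: both guards in the case formulas fail, whatever
      \<open>\<Delta>\<close> is, and the closed formulas hold vacuously.\<close>
    case False
    then have "backward N a y = \<infinity>" if "y \<in> {0..M}" for y
      using bwd[OF that] that M by (auto simp: b_def)
    moreover have "forward N a (ereal x) = -\<infinity>" if "x \<in> {0..M}" for x
      using fwd[OF that] that False by auto
    ultimately show ?thesis using M by auto
  next
    case True
    have b0: "backward N a 0 = ereal b"
      using bwd[of 0] True M by (simp add: b_def)
    have \<Delta>: "\<Delta> = ereal (min (c - b) increment)"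
      using assms(10) fwd[of b] True M \<open>0 \<le> b\<close> unfolding b0 by (auto simp: min_def)
    have fM: "forward N a (ereal M) = ereal (min c (M + increment))"
      using fwd[of M] True M by simp
    have "forward N a (ereal x) =
        (if backward N a 0 \<le> ereal x then min (forward N a (ereal M)) (ereal x + \<Delta>) else -\<infinity>)"
      if "x \<in> {0..M}" for x
    proof -
      \<comment> \<open>The two extra terms are absorbed: \<open>x \<le> M\<close> gives
        \<open>x + increment \<le> M + increment\<close>, and \<open>b \<le> x\<close> gives
        \<open>c \<le> x + (c - b)\<close>.\<close>
      have "min c (x + increment) = min (min c (M + increment)) (x + min (c - b) increment)" if "b \<le> x"
        using that \<open>x \<in> {0..M}\<close> by auto
      then show ?thesis
        using fwd[OF that] unfolding b0 \<Delta> fM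
        by (simp only: ereal_less_eq plus_ereal.simps flip: ereal_min) simp
    qed
    moreover have "backward N a y =
        (if ereal y \<le> forward N a (ereal M)
         then backward N a 0 + max 0 (ereal y - (backward N a 0 + \<Delta>)) else \<infinity>)"
      if "y \<in> {0..M}" for y
    proof -
      \<comment> \<open>The right side is the maximum of \<open>b\<close>,
        \<open>y - increment\<close> and \<open>b + (y - c)\<close>; the last is at most
        \<open>b\<close> because \<open>y \<le> c\<close>.\<close>
      have "max b (y - increment) = b + max 0 (y - (b + min (c - b) increment))" if "y \<le> c"
        using that by linarith
      then have "backward N a y = (if y \<le> min c (M + increment)
          then ereal (b + max 0 (y - (b + min (c - b) increment))) else \<infinity>)"
        using bwd[OF that] by auto
      then show ?thesis
        unfolding b0 \<Delta> fM
        by (simp only: ereal_less_eq zero_ereal_def plus_ereal.simps ereal_minus flip: ereal_max)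
    qed
    moreover have "forward N a (ereal M) =
        ereal (min M (M + l_av - (\<Sum>i=1..k. leg_energy N (a ! (i - 1)) (a ! i)))
               - leg_energy N (a ! k) v - energy N v)"
      using assms(2,6) endpoints unfolding fM l_av c_def total by (auto simp: min_def)
    \<comment> \<open>The extra term \<open>M + increment - b\<close> is at least
      \<open>increment\<close> because \<open>b \<le> M\<close>.\<close>
    moreover have "\<Delta> = min (ereal \<Delta>_inc) (forward N a (ereal M) - backward N a 0)"
      using True unfolding b0 \<Delta> fM inc by (auto simp: min_def)
    moreover have "backward N a 0 = ereal (max (leg_energy N u (a ! 1)) (- \<Delta>_inc))"
      unfolding b0 b_def inc by (simp add: endpoints)
    ultimately show ?thesis by blast
  qed
qed

end
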